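(* Let $m,n\ge1$ be integers, let $\omega\subset\mathbb{R}^m$ be nonempty and let $u:\omega\to\mathbb{R}^n$ be a Lipschitz function with $l:=\mathrm{Lip}(u;\omega)>0$. Define $k^+,k^-:\mathbb{R}^m\to\mathbb{R}^n$ by $$k^+(x)=\Big(\arg\max_{v\in\Lambda_x}\inf_{a\in\omega}\Phi^+(u,x,a,v)\Big)^{(n)},\qquad k^-(x)=\Big(\arg\min_{v\in\Lambda_x}\sup_{a\in\omega}\Phi^-(u,x,a,v)\Big)^{(n)}.$$ Then $k^+$ and $k^-$ are minimal Lipschitz extensions of $u$, i.e. $k^\pm=u$ on $\omega$ and $\mathrm{Lip}(k^\pm;\mathbb{R}^m)=\mathrm{Lip}(u;\omega)$.
   Context: Euclidean spaces carry the standard scalar product and norm. For a map $u$ on a set $S$, $\mathrm{Lip}(u;S)=\sup_{x\ne y\in S}\|u(x)-u(y)\|/\|x-y\|$; $u$ is Lipschitz if this is finite. Elements $v\in\mathbb{R}^{m+n}=\mathbb{R}^m\times\mathbb{R}^n$ are written $v=(v^{(m)},v^{(n)})$. For $a,b\in\omega$ and $x\in\mathbb{R}^m$ set $$v_{a,b}=\left(\tfrac l2(b-a),\ \tfrac12(u(a)+u(b))\right)\in\mathbb{R}^m\times\mathbb{R}^n,$$ $$\alpha_{a,b}=-\tfrac12\|u(a)-u(b)\|^2+\tfrac{l^2}{2}\|a-b\|^2,$$ $$\beta_{a,b}(x)=\left\|\tfrac l2(2x-a-b)\right\|^2+\left\|\tfrac12(u(a)-u(b))\right\|^2,\qquad r_{a,b}(x)=\sqrt{\alpha_{a,b}+\beta_{a,b}(x)},$$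 $$\Lambda_x=\{v\in\mathbb{R}^{m+n}:\ \|v-v_{a,b}\|\le r_{a,b}(x)\ \text{for all }a,b\in\omega\}.$$ For $v\in\mathbb{R}^{m+n}$, $a\in\omega$, $x\in\mathbb{R}^m$, $$\Phi^+(u,x,a,v)=\tfrac12\langle v^{(m)},x-a\rangle+\tfrac l4\|a-x\|^2-\tfrac1{4l}\left(\|v^{(m)}\|^2+\|u(a)-v^{(n)}\|^2\right),$$ $$\Phi^-(u,x,a,v)=\tfrac12\langle v^{(m)},x-a\rangle-\tfrac l4\|a-x\|^2+\tfrac1{4l}\left(\|v^{(m)}\|^2+\|u(a)-v^{(n)}\|^2\right).$$ The set $\Lambda_x$ is nonempty and the maximizer and minimizer over $\Lambda_x$ exist and are unique, so $k^\pm$ are well defined. *)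

theory Defs
  imports "HOL-Analysis.Analysis"
begin

text \<open>
  The supremum is taken in \<^typ>\<open>ennreal\<close>, so it always exists (and is 0 if the set
  has at most one point); a map is Lipschitz iff the value is finite.
\<close>

definition Lip :: "('a::real_normed_vector \<Rightarrow> 'b::real_normed_vector) \<Rightarrow> 'a set \<Rightarrow> ennreal" where
  "Lip u S = (SUP (x, y)\<in>{(x, y). x \<in> S \<and> y \<in> S \<and> x \<noteq> y}.
      ennreal (norm (u x - u y) / norm (x - y)))"

definition is_Lipschitz :: "('a::real_normed_vector \<Rightarrow> 'b::real_normed_vector) \<Rightarrow> 'a set \<Rightarrow> bool" where
  "is_Lipschitz u S \<longleftrightarrow> Lip u S < \<infinity>"

definition minimal_Lipschitz_extension ::
  "('a::real_normed_vector \<Rightarrow> 'b::real_normed_vector) \<Rightarrow> ('a \<Rightarrow> 'b) \<Rightarrow> 'a set \<Rightarrow> bool" where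
  "minimal_Lipschitz_extension k u \<omega> \<longleftrightarrow>
     (\<forall>x\<in>\<omega>. k x = u x) \<and> Lip k UNIV = Lip u \<omega>"

text \<open>
  The space $R^{m+n}$ is the product type of $R^m$ and $R^n$, whose library norm and inner product
  are the Euclidean ones; \<^const>\<open>fst\<close> and \<^const>\<open>snd\<close> are the two components of
  a vector. In the definitions below only the values of \<open>u\<close> on \<open>\<omega>\<close> matter,
  and the parameter \<open>l\<close> stands for the Lipschitz constant of \<open>u\<close> on \<open>\<omega>\<close>.
\<close>

definition v_mid :: "real \<Rightarrow> (real^'m \<Rightarrow> real^'n) \<Rightarrow> real^'m \<Rightarrow> real^'m \<Rightarrow> (real^'m) \<times> (real^'n)" where
  "v_mid l u a b = ((l / 2) *\<^sub>R (b - a), (1 / 2) *\<^sub>R (u a + u b))"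

definition alpha :: "real \<Rightarrow> (real^'m \<Rightarrow> real^'n) \<Rightarrow> real^'m \<Rightarrow> real^'m \<Rightarrow> real" where
  "alpha l u a b = - (1 / 2) * (norm (u a - u b))\<^sup>2 + l\<^sup>2 / 2 * (norm (a - b))\<^sup>2"

definition beta :: "real \<Rightarrow> (real^'m \<Rightarrow> real^'n) \<Rightarrow> real^'m \<Rightarrow> real^'m \<Rightarrow> real^'m \<Rightarrow> real" where
  "beta l u a b x = (norm ((l / 2) *\<^sub>R (2 *\<^sub>R x - a - b)))\<^sup>2
      + (norm ((1 / 2) *\<^sub>R (u a - u b)))\<^sup>2"

definition rad :: "real \<Rightarrow> (real^'m \<Rightarrow> real^'n) \<Rightarrow> real^'m \<Rightarrow> real^'m \<Rightarrow> real^'m \<Rightarrow> real" where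
  "rad l u a b x = sqrt (alpha l u a b + beta l u a b x)"

definition Lambda_set ::
  "real \<Rightarrow> (real^'m \<Rightarrow> real^'n) \<Rightarrow> (real^'m) set \<Rightarrow> real^'m \<Rightarrow> ((real^'m) \<times> (real^'n)) set" where
  "Lambda_set l u \<omega> x = {v. \<forall>a\<in>\<omega>. \<forall>b\<in>\<omega>. norm (v - v_mid l u a b) \<le> rad l u a b x}"

definition Phi_plus ::
  "real \<Rightarrow> (real^'m \<Rightarrow> real^'n) \<Rightarrow> real^'m \<Rightarrow> real^'m \<Rightarrow> (real^'m) \<times> (real^'n) \<Rightarrow> real" where
  "Phi_plus l u x a v = 1 / 2 * (fst v \<bullet> (x - a)) + l / 4 * (norm (a - x))\<^sup>2
      - 1 / (4 * l) * ((norm (fst v))\<^sup>2 + (norm (u a - snd v))\<^sup>2)"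

definition Phi_minus ::
  "real \<Rightarrow> (real^'m \<Rightarrow> real^'n) \<Rightarrow> real^'m \<Rightarrow> real^'m \<Rightarrow> (real^'m) \<times> (real^'n) \<Rightarrow> real" where
  "Phi_minus l u x a v = 1 / 2 * (fst v \<bullet> (x - a)) - l / 4 * (norm (a - x))\<^sup>2
      + 1 / (4 * l) * ((norm (fst v))\<^sup>2 + (norm (u a - snd v))\<^sup>2)"

text \<open>
  Infimum and supremum over \<open>\<omega>\<close> are taken in the extended reals, since
  \<open>\<omega>\<close> may be unbounded. The maximizer and the minimizer are unique, so the choice made by
  \<^const>\<open>arg_max\<close> and \<^const>\<open>arg_min\<close> is immaterial.
\<close>

definition k_plus :: "real \<Rightarrow> (real^'m \<Rightarrow> real^'n) \<Rightarrow> (real^'m) set \<Rightarrow> real^'m \<Rightarrow> real^'n" where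
  "k_plus l u \<omega> x =
     snd (ARG_MAX (\<lambda>v. INF a\<in>\<omega>. ereal (Phi_plus l u x a v)) v. v \<in> Lambda_set l u \<omega> x)"

definition k_minus :: "real \<Rightarrow> (real^'m \<Rightarrow> real^'n) \<Rightarrow> (real^'m) set \<Rightarrow> real^'m \<Rightarrow> real^'n" where
  "k_minus l u \<omega> x =
     snd (ARG_MIN (\<lambda>v. SUP a\<in>\<omega>. ereal (Phi_minus l u x a v)) v. v \<in> Lambda_set l u \<omega> x)"

end

theory Submission
  imports Defs
begin

text \<open>
  Attach to each \<open>a\<close> in \<open>\<omega>\<close> the 1-jet at the point \<open>(a, 0)\<close> with value \<open>0\<close> and gradient
  \<open>(0, u a)\<close>. The set \<^const>\<open>Lambda_set\<close> then consists of the gradients with which this field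
  of jets extends to the further point \<open>(x, 0)\<close> with constant \<open>l\<close>: membership says that every
  lower bound \<^const>\<open>Phi_minus\<close> for the new value lies below every upper bound
  \<^const>\<open>Phi_plus\<close>. The maximizer in \<^const>\<open>k_plus\<close> is the gradient belonging to the
  largest possible value.

  Everything follows from one property of \<open>J x v = (INF a\<in>\<omega>. Phi_plus l u x a v)\<close>. As a function
  of \<open>v\<close> it is \<open>- (norm v)\<^sup>2 / (4 * l)\<close> plus an infimum of affine functions, hence strongly
  concave. So it has a maximizer \<open>p x\<close> over the whole space, with maximum \<open>S x\<close>, and
  \<open>J x v + (norm (v - p x))\<^sup>2 / (4 * l) \<le> S x\<close> for all \<open>v\<close> (lemma \<open>ex_quadratic_peak\<close>).
  Moving \<open>x\<close> to \<open>y\<close> while replacing \<open>v\<close> by \<open>v + l * (x - y, 0)\<close> changes all the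
  \<^const>\<open>Phi_plus\<close> by the same amount (lemma \<open>Phi_plus_translate\<close>). The peak inequality is
  therefore available with test points coming from other base points:

  \<^item> With the translated maximizer at another point \<open>y\<close> it gives the jet compatibility
    inequality between \<open>x\<close> and \<open>y\<close>; adding the one with \<open>x\<close> and \<open>y\<close> exchanged
    gives \<open>norm (p x - p y) \<le> l * norm (x - y)\<close>.
  \<^item> With the translated data gradient \<open>(0, u b)\<close> it gives \<open>Phi_minus l u x b (p x) \<le> S x\<close>,
    so the unconstrained maximizer already lies in \<^const>\<open>Lambda_set\<close> and is the constrained one.
  \<^item> At \<open>x = b\<close> in \<open>\<omega>\<close> it forces \<open>p b = (0, u b)\<close>.

  Hence \<open>snd (p x)\<close>, which is the value of \<^const>\<open>k_plus\<close> at \<open>x\<close>, is an \<open>l\<close>-Lipschitz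
  extension of \<open>u\<close>. The reflection \<open>(v, w) \<mapsto> (- v, w)\<close> preserves \<^const>\<open>Lambda_set\<close> and turns
  \<^const>\<open>Phi_minus\<close> into the negative of \<^const>\<open>Phi_plus\<close>, so \<^const>\<open>k_minus\<close> is the same map
  as \<^const>\<open>k_plus\<close>.
\<close>

section \<open>Peaks of infima of concave quadratics\<close>

text \<open>
  What strong concavity of the infimum of the \<open>\<phi> i\<close> says about its maximizer \<open>p\<close>. Lower bounds
  \<open>t\<close> stand in for the infimum, since it is minus infinity at points where the family is unbounded
  below.
\<close>
definition quadratic_peak ::
  "('i \<Rightarrow> 'a::real_normed_vector \<Rightarrow> real) \<Rightarrow> 'i set \<Rightarrow> real \<Rightarrow> 'a \<Rightarrow> real \<Rightarrow> bool" where
  "quadratic_peak \<phi> I \<kappa> p S \<longleftrightarrow>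
     (\<forall>i\<in>I. S \<le> \<phi> i p) \<and> (\<forall>v t. (\<forall>i\<in>I. t \<le> \<phi> i v) \<longrightarrow> t + \<kappa> * (norm (v - p))\<^sup>2 \<le> S)"

lemma quadratic_peakD:
  assumes "quadratic_peak \<phi> I \<kappa> p S"
  shows "i \<in> I \<Longrightarrow> S \<le> \<phi> i p"
    and "(\<And>i. i \<in> I \<Longrightarrow> t \<le> \<phi> i v) \<Longrightarrow> t + \<kappa> * (norm (v - p))\<^sup>2 \<le> S"
  using assms by (auto simp: quadratic_peak_def)

lemma concave_quadratic_on_segment:
  fixes p v w :: "'a::real_inner" and c \<kappa> :: real
  defines "q \<equiv> \<lambda>v. c + w \<bullet> v - \<kappa> * (norm v)\<^sup>2"
  shows "q (p + s *\<^sub>R (v - p)) = (1 - s) * q p + s * q v + \<kappa> * s * (1 - s) * (norm (v - p))\<^sup>2"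
  unfolding q_def power2_norm_eq_inner
  by (simp add: algebra_simps inner_commute power2_eq_square)

text \<open>
  Half of the quadratic term absorbs the linear one, which leaves a bound that still tends to
  minus infinity; it makes superlevel sets bounded.
\<close>
lemma concave_quadratic_upper_bound:
  fixes v w :: "'a::real_inner"
  assumes "\<kappa> > 0"
  shows "w \<bullet> v - \<kappa> * (norm v)\<^sup>2 \<le> (norm w)\<^sup>2 / (2 * \<kappa>) - \<kappa> / 2 * (norm v)\<^sup>2"
proof -
  have "0 \<le> (norm (w - \<kappa> *\<^sub>R v))\<^sup>2" by simp
  then have "2 * \<kappa> * (w \<bullet> v) \<le> (norm w)\<^sup>2 + \<kappa>\<^sup>2 * (norm v)\<^sup>2"
    unfolding power2_norm_eq_inner by (simp add: algebra_simps inner_commute power2_eq_square)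
  with assms show ?thesis
    by (simp add: field_simps power2_eq_square)
qed

text \<open>
  The superlevel sets at levels tending to the supremum are closed, nested and bounded, so they
  share a point \<open>p\<close>. The drop-off holds because along the segment from \<open>p\<close> to \<open>v\<close> the infimum
  exceeds linear interpolation by \<open>\<kappa> * s * (1 - s) * (norm (v - p))\<^sup>2\<close>, yet never exceeds
  the maximum; dividing by \<open>s\<close> and letting \<open>s\<close> tend to \<open>0\<close> gives the full constant \<open>\<kappa>\<close>.
\<close>
lemma ex_quadratic_peak:
  fixes w :: "'i \<Rightarrow> 'a::euclidean_space"
  assumes "I \<noteq> {}" and "\<kappa> > 0"
    and \<phi>: "\<And>i v. \<phi> i v = c i + w i \<bullet> v - \<kappa> * (norm v)\<^sup>2"
    and low: "\<And>i. i \<in> I \<Longrightarrow> t0 \<le> \<phi> i v0"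
  shows "\<exists>p S. quadratic_peak \<phi> I \<kappa> p S"
proof -
  obtain j where j: "j \<in> I" using assms by blast
  define C where "C = c j + (norm (w j))\<^sup>2 / (2 * \<kappa>)"
  have upper: "\<phi> j v \<le> C - \<kappa> / 2 * (norm v)\<^sup>2" for v
    using concave_quadratic_upper_bound[OF \<open>\<kappa> > 0\<close>, of "w j" v] by (simp add: \<phi> C_def)
  define T where "T = {t. \<exists>v. \<forall>i\<in>I. t \<le> \<phi> i v}"
  have "t \<le> C" if "t \<in> T" for t
  proof -
    from that j obtain v where "t \<le> \<phi> j v" by (auto simp: T_def)
    moreover have "0 \<le> \<kappa> / 2 * (norm v)\<^sup>2" using \<open>\<kappa> > 0\<close> by simp
    ultimately show ?thesis using upper[of v] by linarith
  qed
  then have bdd: "bdd_above T" by (auto simp: bdd_above_def)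
  have "t0 \<in> T" using low by (auto simp: T_def)
  define S where "S = Sup T"
  define K where "K n = {v. \<forall>i\<in>I. S - 1 / real (Suc n) \<le> \<phi> i v}" for n
  have "closed (K n)" for n
  proof -
    have "K n = (\<Inter>i\<in>I. {v. S - 1 / real (Suc n) \<le> \<phi> i v})" by (auto simp: K_def)
    moreover have "closed {v. S - 1 / real (Suc n) \<le> \<phi> i v}" for i
      unfolding \<phi> by (intro closed_Collect_le continuous_intros)
    ultimately show ?thesis by auto
  qed
  moreover have "K n \<noteq> {}" for n
  proof -
    have "S - 1 / real (Suc n) < Sup T" by (simp add: S_def)
    then obtain t where t: "t \<in> T" "S - 1 / real (Suc n) < t"
      using less_cSup_iff[OF _ bdd] \<open>t0 \<in> T\<close> by blast
    then obtain v where "\<forall>i\<in>I. t \<le> \<phi> i v" by (auto simp: T_def)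
    then have "v \<in> K n" using t by (auto simp: K_def intro: order_trans less_imp_le)
    then show ?thesis by blast
  qed
  moreover have "K n \<subseteq> K m" if "m \<le> n" for m n
  proof -
    have "1 / real (Suc n) \<le> 1 / real (Suc m)" using that by (simp add: field_simps)
    then show ?thesis by (fastforce simp: K_def)
  qed
  moreover have "bounded (K 0)"
  proof -
    have "norm v \<le> sqrt (2 / \<kappa> * (C - S + 1))" if "v \<in> K 0" for v
    proof (rule real_le_rsqrt)
      have "S - 1 \<le> C - \<kappa> / 2 * (norm v)\<^sup>2"
        using that j upper[of v] by (force simp: K_def)
      then show "(norm v)\<^sup>2 \<le> 2 / \<kappa> * (C - S + 1)"
        using \<open>\<kappa> > 0\<close> by (simp add: field_simps)
    qed
    then show ?thesis by (auto simp: bounded_iff)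
  qed
  ultimately obtain p where p: "p \<in> K n" for n
    using bounded_closed_nest[of K] by blast
  have S_le: "S \<le> \<phi> i p" if "i \<in> I" for i
  proof (rule field_le_epsilon)
    fix e :: real assume "e > 0"
    then obtain n where "1 / real (Suc n) < e" using nat_approx_posE by blast
    then show "S \<le> \<phi> i p + e" using p[of n] that by (force simp: K_def)
  qed
  have "t + \<kappa> * (norm (v - p))\<^sup>2 \<le> S" if t: "\<And>i. i \<in> I \<Longrightarrow> t \<le> \<phi> i v" for v t
  proof -
    define d where "d = \<kappa> * (norm (v - p))\<^sup>2"
    have *: "t + (1 - s) * d \<le> S" if s: "0 < s" "s < 1" for s
    proof -
      have "(1 - s) * S + s * t + s * (1 - s) * d \<le> \<phi> i (p + s *\<^sub>R (v - p))" if "i \<in> I" for i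
      proof -
        have "\<phi> i (p + s *\<^sub>R (v - p)) = (1 - s) * \<phi> i p + s * \<phi> i v + s * (1 - s) * d"
          unfolding \<phi> d_def concave_quadratic_on_segment by simp
        moreover have "(1 - s) * S \<le> (1 - s) * \<phi> i p"
          using S_le[OF that] s by (intro mult_left_mono) auto
        moreover have "s * t \<le> s * \<phi> i v" using t[OF that] s by simp
        ultimately show ?thesis by linarith
      qed
      then have "(1 - s) * S + s * t + s * (1 - s) * d \<in> T" by (auto simp: T_def)
      then have "(1 - s) * S + s * t + s * (1 - s) * d \<le> S"
        unfolding S_def by (rule cSup_upper[OF _ bdd])
      then have "s * (t + (1 - s) * d) \<le> s * S" by (simp add: algebra_simps)
      then show ?thesis using s by simp
    qed
    have "((\<lambda>s. t + (1 - s) * d) \<longlongrightarrow> t + (1 - 0) * d) (at_right 0)"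
      by (intro tendsto_intros)
    moreover have "eventually (\<lambda>s. t + (1 - s) * d \<le> S) (at_right 0)"
      using * by (intro eventually_at_rightI[of 0 1]) auto
    ultimately have "t + (1 - 0) * d \<le> S"
      by (rule tendsto_upperbound) simp
    then show ?thesis by (simp add: d_def)
  qed
  with S_le show ?thesis unfolding quadratic_peak_def by blast
qed

lemma INF_less_at_quadratic_peak:
  assumes peak: "quadratic_peak \<phi> I \<kappa> p S" and "\<kappa> > 0" and "v \<noteq> p"
  shows "(INF i\<in>I. ereal (\<phi> i v)) < (INF i\<in>I. ereal (\<phi> i p))" (is "?J v < ?J p")
proof (rule ccontr)
  assume "\<not> ?J v < ?J p"
  moreover have "ereal S \<le> ?J p"
    using quadratic_peakD(1)[OF peak] by (auto intro: INF_greatest)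
  ultimately have "ereal S \<le> ?J v" by simp
  then have "S \<le> \<phi> i v" if "i \<in> I" for i
    using order_trans[OF _ INF_lower[OF that], of "ereal S" "\<lambda>i. ereal (\<phi> i v)"] by simp
  then have "S + \<kappa> * (norm (v - p))\<^sup>2 \<le> S" by (rule quadratic_peakD(2)[OF peak])
  then show False using \<open>\<kappa> > 0\<close> \<open>v \<noteq> p\<close> by (simp add: mult_le_0_iff)
qed

lemma arg_max_eqI:
  fixes f :: "'a \<Rightarrow> 'b::order"
  assumes "P p" and "\<And>v. P v \<Longrightarrow> v \<noteq> p \<Longrightarrow> f v < f p"
  shows "arg_max f P = p"
  unfolding arg_max_def is_arg_max_def
  by (rule some_equality) (use assms in \<open>auto dest: less_asym\<close>)

lemma arg_min_eqI:
  fixes f :: "'a \<Rightarrow> 'b::order"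
  assumes "P p" and "\<And>v. P v \<Longrightarrow> v \<noteq> p \<Longrightarrow> f p < f v"
  shows "arg_min f P = p"
  unfolding arg_min_def is_arg_min_def
  by (rule some_equality) (use assms in \<open>auto dest: less_asym\<close>)

section \<open>The functions bounding the value of an extension\<close>

lemma Phi_plus_quadratic:
  assumes "l > 0"
  shows "Phi_plus l u x a v =
    (l / 4 * (norm (a - x))\<^sup>2 - (norm (u a))\<^sup>2 / (4 * l))
      + ((1 / 2) *\<^sub>R (x - a), (1 / (2 * l)) *\<^sub>R u a) \<bullet> v - 1 / (4 * l) * (norm v)\<^sup>2"
  using assms unfolding Phi_plus_def power2_norm_eq_inner inner_prod_def
  by (simp add: inner_diff_left inner_diff_right inner_commute field_simps)

text \<open>
  Adding \<open>l / 2 * (norm x)\<^sup>2\<close> to the extension turns its gradient into \<open>v + (l *\<^sub>R x, 0)\<close>. With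
  this modified gradient held fixed, \<^const>\<open>Phi_plus\<close> depends on \<open>x\<close> only through terms free of
  \<open>a\<close>, so a change of base point shifts all members of the family alike.
\<close>
lemma Phi_plus_translate:
  assumes "l > 0"
  shows "Phi_plus l u x a (w + (l *\<^sub>R (y - x), 0)) =
    Phi_plus l u y a w + fst w \<bullet> (x - y) - l / 2 * (norm (x - y))\<^sup>2"
  using assms unfolding Phi_plus_def power2_norm_eq_inner
  by (simp add: inner_diff_left inner_diff_right inner_add_left inner_add_right inner_commute field_simps)

text \<open>
  The centre of the square is the data gradient \<open>(0, u b)\<close> translated from \<open>b\<close> to \<open>x\<close>, and the
  remaining term is the bound of lemma \<open>Phi_plus_shifted_data\<close> at that centre. This is why the
  drop-off of a peak from the translated data gradient is exactly a bound on \<^const>\<open>Phi_minus\<close>.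
\<close>
lemma Phi_minus_complete_square:
  assumes "l > 0"
  shows "Phi_minus l u x b v =
    1 / (4 * l) * (norm ((l *\<^sub>R (b - x), u b) - v))\<^sup>2 - l / 2 * (norm (x - b))\<^sup>2"
  using assms unfolding Phi_minus_def power2_norm_eq_inner inner_prod_def
  by (simp add: inner_diff_left inner_diff_right inner_add_left inner_add_right
      inner_commute field_simps)

text \<open>
  Completing the square in \<open>Phi_minus l u x b v \<le> Phi_plus l u x a v\<close> yields the ball with centre
  \<^const>\<open>v_mid\<close> and radius \<^const>\<open>rad\<close>.
\<close>
lemma Lambda_setI:
  assumes "l > 0"
    and le: "\<And>a b. a \<in> \<omega> \<Longrightarrow> b \<in> \<omega> \<Longrightarrow> Phi_minus l u x b v \<le> Phi_plus l u x a v"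
  shows "v \<in> Lambda_set l u \<omega> x"
proof -
  have "norm (v - v_mid l u a b) \<le> rad l u a b x" if "a \<in> \<omega>" "b \<in> \<omega>" for a b
    unfolding rad_def
  proof (rule real_le_rsqrt)
    have "alpha l u a b + beta l u a b x - (norm (v - v_mid l u a b))\<^sup>2
        = 2 * l * (Phi_plus l u x a v - Phi_minus l u x b v)"
      using \<open>l > 0\<close>
      unfolding Phi_minus_def Phi_plus_def alpha_def beta_def v_mid_def power2_norm_eq_inner
        inner_prod_def
      by (simp add: inner_diff_left inner_diff_right inner_add_left inner_add_right inner_commute
          field_simps power2_eq_square)
    moreover have "0 \<le> 2 * l * (Phi_plus l u x a v - Phi_minus l u x b v)"
      using \<open>l > 0\<close> le[OF that] by simp
    ultimately show "(norm (v - v_mid l u a b))\<^sup>2 \<le> alpha l u a b + beta l u a b x" by linarith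
  qed
  then show ?thesis by (simp add: Lambda_set_def)
qed

text \<open>
  The Lipschitz condition on the data is what makes the jets at \<open>(a, 0)\<close> and \<open>(b, 0)\<close> compatible:
  the value \<open>0\<close> of the latter respects the upper bound coming from the former.
\<close>
lemma Phi_plus_data_nonneg:
  assumes "l > 0" and "norm (u a - u b) \<le> l * norm (a - b)"
  shows "0 \<le> Phi_plus l u b a (0, u b)"
proof -
  have "(norm (u a - u b))\<^sup>2 \<le> (l * norm (a - b))\<^sup>2" using assms(2) by (intro power_mono) auto
  then show ?thesis
    using \<open>l > 0\<close> by (simp add: Phi_plus_def field_simps power2_eq_square)
qed

lemma Phi_plus_shifted_data:
  assumes "l > 0" and "norm (u a - u b) \<le> l * norm (a - b)"
  shows "- (l / 2 * (norm (x - b))\<^sup>2) \<le> Phi_plus l u x a (l *\<^sub>R (b - x), u b)"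
  using Phi_plus_translate[OF \<open>l > 0\<close>, of u x a "(0, u b)" b] Phi_plus_data_nonneg[of l u a b] assms by simp

section \<open>The unconstrained maximizer\<close>

definition sup_inf_peak ::
  "real \<Rightarrow> (real^'m \<Rightarrow> real^'n) \<Rightarrow> (real^'m) set \<Rightarrow> real^'m \<Rightarrow> (real^'m) \<times> (real^'n) \<Rightarrow> real \<Rightarrow> bool" where
  "sup_inf_peak l u \<omega> x = quadratic_peak (Phi_plus l u x) \<omega> (1 / (4 * l))"

text \<open>
  If \<open>\<omega>\<close> is unbounded, the infimum of the \<^const>\<open>Phi_plus\<close> may be minus infinity at some points;
  the translated data gradient of any \<open>b\<close> in \<open>\<omega>\<close> is a point where it is not.
\<close>
lemma ex_sup_inf_peak:
  assumes "\<omega> \<noteq> {}" "l > 0"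
    and lip: "\<And>a b. a \<in> \<omega> \<Longrightarrow> b \<in> \<omega> \<Longrightarrow> norm (u a - u b) \<le> l * norm (a - b)"
  shows "\<exists>p S. sup_inf_peak l u \<omega> x p S"
proof -
  obtain b where "b \<in> \<omega>" using assms(1) by blast
  show ?thesis
    unfolding sup_inf_peak_def
  proof (rule ex_quadratic_peak[OF \<open>\<omega> \<noteq> {}\<close> _ Phi_plus_quadratic[OF \<open>l > 0\<close>]])
    show "- (l / 2 * (norm (x - b))\<^sup>2) \<le> Phi_plus l u x a (l *\<^sub>R (b - x), u b)" if "a \<in> \<omega>" for a
      using \<open>l > 0\<close> lip[OF that \<open>b \<in> \<omega>\<close>] by (rule Phi_plus_shifted_data)
  qed (use \<open>l > 0\<close> in simp)
qed

text \<open>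
  The maximum \<open>S\<close> separates the lower bounds from the upper ones. It lies above
  \<open>Phi_minus l u x b p\<close> by the drop-off from the translated data gradient of \<open>b\<close>.
\<close>
lemma sup_inf_peak_in_Lambda_set:
  assumes peak: "sup_inf_peak l u \<omega> x p S" and "l > 0"
    and lip: "\<And>a b. a \<in> \<omega> \<Longrightarrow> b \<in> \<omega> \<Longrightarrow> norm (u a - u b) \<le> l * norm (a - b)"
  shows "p \<in> Lambda_set l u \<omega> x"
proof (rule Lambda_setI[OF \<open>l > 0\<close>])
  fix a b assume ab: "a \<in> \<omega>" "b \<in> \<omega>"
  have "Phi_minus l u x b p
      = - (l / 2 * (norm (x - b))\<^sup>2) + 1 / (4 * l) * (norm ((l *\<^sub>R (b - x), u b) - p))\<^sup>2"
    using Phi_minus_complete_square[OF \<open>l > 0\<close>, of u x b p] by simp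
  also have "\<dots> \<le> S"
    using \<open>l > 0\<close> lip[OF _ \<open>b \<in> \<omega>\<close>]
    by (intro quadratic_peakD(2)[OF peak[unfolded sup_inf_peak_def]] Phi_plus_shifted_data)
  also have "S \<le> Phi_plus l u x a p"
    by (rule quadratic_peakD(1)[OF peak[unfolded sup_inf_peak_def] ab(1)])
  finally show "Phi_minus l u x b p \<le> Phi_plus l u x a p" .
qed

text \<open>
  At \<open>x = b\<close> the value \<open>0\<close> is attained at \<open>(0, u b)\<close>, while the member \<open>a = b\<close> of the family is
  nowhere positive. So the maximum is \<open>0\<close> and there is no room for a drop-off.
\<close>
lemma sup_inf_peak_at_data:
  assumes peak: "sup_inf_peak l u \<omega> b p S" and "l > 0" and "b \<in> \<omega>"
    and lip: "\<And>a. a \<in> \<omega> \<Longrightarrow> norm (u a - u b) \<le> l * norm (a - b)"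
  shows "p = (0, u b)"
proof -
  note peak' = peak[unfolded sup_inf_peak_def]
  have "0 + 1 / (4 * l) * (norm ((0, u b) - p))\<^sup>2 \<le> S"
    using \<open>l > 0\<close> lip by (intro quadratic_peakD(2)[OF peak'] Phi_plus_data_nonneg)
  also have "S \<le> Phi_plus l u b b p" by (rule quadratic_peakD(1)[OF peak' \<open>b \<in> \<omega>\<close>])
  also have "\<dots> \<le> 0" using \<open>l > 0\<close> by (simp add: Phi_plus_def)
  finally show ?thesis using \<open>l > 0\<close> by (simp add: field_simps mult_le_0_iff)
qed

text \<open>
  The interpolation inequality between the jets with values \<open>S\<close>, \<open>T\<close> and gradients \<open>p\<close>, \<open>q\<close>: it is
  the drop-off at \<open>x\<close> tested at the maximizer for \<open>y\<close>, translated to \<open>x\<close>.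
\<close>
lemma sup_inf_peak_field_condition:
  assumes x: "sup_inf_peak l u \<omega> x p S" and y: "sup_inf_peak l u \<omega> y q T" and "l > 0"
  shows "T + 1 / 2 * ((fst p + fst q) \<bullet> (x - y))
    + 1 / (4 * l) * (norm (p - q))\<^sup>2 - l / 4 * (norm (x - y))\<^sup>2 \<le> S"
proof -
  \<comment> \<open>the translate of \<open>q\<close> from base point \<open>y\<close> to base point \<open>x\<close>\<close>
  define q' where "q' = q + (l *\<^sub>R (y - x), 0)"
  have "T + fst q \<bullet> (x - y) - l / 2 * (norm (x - y))\<^sup>2 \<le> Phi_plus l u x a q'" if "a \<in> \<omega>" for a
    using quadratic_peakD(1)[OF y[unfolded sup_inf_peak_def] that]
      Phi_plus_translate[OF \<open>l > 0\<close>, of u x a q y] by (simp add: q'_def)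
  then have "T + fst q \<bullet> (x - y) - l / 2 * (norm (x - y))\<^sup>2 + 1 / (4 * l) * (norm (q' - p))\<^sup>2 \<le> S"
    by (rule quadratic_peakD(2)[OF x[unfolded sup_inf_peak_def]])
  moreover have "(norm (q' - p))\<^sup>2
      = (norm (p - q))\<^sup>2 + 2 * l * ((fst p - fst q) \<bullet> (x - y)) + l\<^sup>2 * (norm (x - y))\<^sup>2"
  proof -
    have "q' - p = - ((p - q) + l *\<^sub>R (x - y, 0))"
      by (simp add: q'_def prod_eq_iff algebra_simps)
    then have "(norm (q' - p))\<^sup>2 = (norm ((p - q) + l *\<^sub>R (x - y, 0)))\<^sup>2"
      by (simp only: norm_minus_cancel)
    also have "\<dots> = (norm (p - q))\<^sup>2 + 2 * ((p - q) \<bullet> (l *\<^sub>R (x - y, 0)))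
        + (norm (l *\<^sub>R (x - y, 0 :: real^'b)))\<^sup>2"
      unfolding power2_norm_eq_inner by (simp add: inner_add_left inner_add_right inner_commute)
    finally show ?thesis by (simp add: inner_prod_def power_mult_distrib)
  qed
  ultimately show ?thesis
    using \<open>l > 0\<close> by (simp add: inner_add_left inner_diff_left field_simps power2_eq_square)
qed

text \<open>
  In the sum of the two field conditions the values and the inner products cancel.
\<close>
lemma sup_inf_peak_Lipschitz:
  assumes x: "sup_inf_peak l u \<omega> x p S" and y: "sup_inf_peak l u \<omega> y q T" and "l > 0"
  shows "norm (p - q) \<le> l * norm (x - y)"
proof -
  have "(fst q + fst p) \<bullet> (y - x) = - ((fst p + fst q) \<bullet> (x - y))"
    by (simp add: algebra_simps)
  then have "1 / (2 * l) * (norm (p - q))\<^sup>2 \<le> l / 2 * (norm (x - y))\<^sup>2"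
    using sup_inf_peak_field_condition[OF x y \<open>l > 0\<close>] sup_inf_peak_field_condition[OF y x \<open>l > 0\<close>]
    by (simp add: norm_minus_commute)
  then have "(norm (p - q))\<^sup>2 \<le> (l * norm (x - y))\<^sup>2"
    using \<open>l > 0\<close> by (simp add: field_simps power2_eq_square)
  then show ?thesis using \<open>l > 0\<close> by (auto intro: power2_le_imp_le)
qed

section \<open>Both formulas compute the maximizer\<close>

lemma k_plus_eq_snd_peak:
  assumes "sup_inf_peak l u \<omega> x p S" and "l > 0"
    and "\<And>a b. a \<in> \<omega> \<Longrightarrow> b \<in> \<omega> \<Longrightarrow> norm (u a - u b) \<le> l * norm (a - b)"
  shows "k_plus l u \<omega> x = snd p"
proof -
  have "(ARG_MAX (\<lambda>v. INF a\<in>\<omega>. ereal (Phi_plus l u x a v)) v. v \<in> Lambda_set l u \<omega> x) = p"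
    using sup_inf_peak_in_Lambda_set[OF assms]
      INF_less_at_quadratic_peak[OF assms(1)[unfolded sup_inf_peak_def]] \<open>l > 0\<close>
    by (intro arg_max_eqI) auto
  then show ?thesis by (simp add: k_plus_def)
qed

definition reflect_fst :: "'a::real_normed_vector \<times> 'b \<Rightarrow> 'a \<times> 'b" where
  "reflect_fst v = (- fst v, snd v)"

lemma reflect_fst_simps [simp]:
  "reflect_fst (reflect_fst v) = v" "fst (reflect_fst v) = - fst v" "snd (reflect_fst v) = snd v"
  by (simp_all add: reflect_fst_def)

lemma Phi_minus_reflect: "Phi_minus l u x a (reflect_fst v) = - Phi_plus l u x a v"
  by (simp add: Phi_minus_def Phi_plus_def)

lemma SUP_Phi_minus_reflect:
  "(SUP a\<in>\<omega>. ereal (Phi_minus l u x a (reflect_fst v))) = - (INF a\<in>\<omega>. ereal (Phi_plus l u x a v))"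
  by (simp add: Phi_minus_reflect ereal_SUP_uminus_eq flip: uminus_ereal.simps)

text \<open>
  The reflection exchanges the balls belonging to \<open>(a, b)\<close> and \<open>(b, a)\<close>.
\<close>
lemma reflect_mem_Lambda_set:
  assumes "v \<in> Lambda_set l u \<omega> x"
  shows "reflect_fst v \<in> Lambda_set l u \<omega> x"
proof -
  have "norm (reflect_fst v - v_mid l u a b) = norm (v - v_mid l u b a)" for a b
  proof -
    have "reflect_fst v - v_mid l u a b = reflect_fst (v - v_mid l u b a)"
      by (simp add: reflect_fst_def v_mid_def prod_eq_iff algebra_simps)
    then show ?thesis by (simp add: norm_prod_def norm_minus_commute)
  qed
  moreover have "rad l u a b x = rad l u b a x" for a b
    by (simp add: rad_def alpha_def beta_def norm_minus_commute algebra_simps)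
  ultimately show ?thesis using assms unfolding Lambda_set_def by force
qed

lemma k_minus_eq_snd_peak:
  assumes "sup_inf_peak l u \<omega> x p S" and "l > 0"
    and "\<And>a b. a \<in> \<omega> \<Longrightarrow> b \<in> \<omega> \<Longrightarrow> norm (u a - u b) \<le> l * norm (a - b)"
  shows "k_minus l u \<omega> x = snd p"
proof -
  have "(ARG_MIN (\<lambda>v. SUP a\<in>\<omega>. ereal (Phi_minus l u x a v)) v. v \<in> Lambda_set l u \<omega> x)
      = reflect_fst p"
  proof (rule arg_min_eqI)
    show "reflect_fst p \<in> Lambda_set l u \<omega> x"
      by (intro reflect_mem_Lambda_set sup_inf_peak_in_Lambda_set[OF assms])
    fix v assume "v \<noteq> reflect_fst p"
    then have "reflect_fst v \<noteq> p" by auto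
    then have "(INF a\<in>\<omega>. ereal (Phi_plus l u x a (reflect_fst v)))
        < (INF a\<in>\<omega>. ereal (Phi_plus l u x a p))"
      using INF_less_at_quadratic_peak[OF assms(1)[unfolded sup_inf_peak_def]] \<open>l > 0\<close> by simp
    then show "(SUP a\<in>\<omega>. ereal (Phi_minus l u x a (reflect_fst p)))
        < (SUP a\<in>\<omega>. ereal (Phi_minus l u x a v))"
      using SUP_Phi_minus_reflect[of l u x p \<omega>] SUP_Phi_minus_reflect[of l u x "reflect_fst v" \<omega>]
      by simp
  qed
  then show ?thesis by (simp add: k_minus_def)
qed

section \<open>Lipschitz constants\<close>

lemma norm_diff_le_Lip:
  assumes "is_Lipschitz u \<omega>" and "a \<in> \<omega>" "b \<in> \<omega>"
  shows "norm (u a - u b) \<le> enn2real (Lip u \<omega>) * norm (a - b)"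
proof (cases "a = b")
  case False
  have "ennreal (norm (u a - u b) / norm (a - b)) \<le> Lip u \<omega>"
    unfolding Lip_def using assms False by (intro SUP_upper2[of "(a, b)"]) auto
  also have "Lip u \<omega> = ennreal (enn2real (Lip u \<omega>))"
    using assms(1) by (simp add: is_Lipschitz_def)
  finally show ?thesis using False by (simp add: divide_le_eq)
qed simp

lemma Lip_le_ennreal:
  assumes "\<And>x y. x \<in> S \<Longrightarrow> y \<in> S \<Longrightarrow> norm (k x - k y) \<le> l * norm (x - y)"
  shows "Lip k S \<le> ennreal l"
  unfolding Lip_def using assms by (intro SUP_least) (auto intro!: ennreal_leI simp: divide_le_eq)

lemma Lip_le_of_extension:
  assumes "\<And>x. x \<in> S \<Longrightarrow> k x = u x" and "S \<subseteq> T"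
  shows "Lip u S \<le> Lip k T"
  unfolding Lip_def
proof (rule SUP_mono)
  fix z assume "z \<in> {(x, y). x \<in> S \<and> y \<in> S \<and> x \<noteq> y}"
  then show "\<exists>z'\<in>{(x, y). x \<in> T \<and> y \<in> T \<and> x \<noteq> y}.
      (case z of (x, y) \<Rightarrow> ennreal (norm (u x - u y) / norm (x - y)))
        \<le> (case z' of (x, y) \<Rightarrow> ennreal (norm (k x - k y) / norm (x - y)))"
    using assms by (intro bexI[of _ z]) auto
qed

theorem theorem27:
  fixes u :: "real^'m \<Rightarrow> real^'n" and \<omega> :: "(real^'m) set" and l :: real
  assumes "\<omega> \<noteq> {}"
    and "is_Lipschitz u \<omega>"
    and "l = enn2real (Lip u \<omega>)"
    and "l > 0"
  shows "minimal_Lipschitz_extension (k_plus l u \<omega>) u \<omega> \<and>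
         minimal_Lipschitz_extension (k_minus l u \<omega>) u \<omega>"
proof -
  have lip: "norm (u a - u b) \<le> l * norm (a - b)" if "a \<in> \<omega>" "b \<in> \<omega>" for a b
    using norm_diff_le_Lip[OF assms(2) that] assms(3) by simp
  have Lip_u: "Lip u \<omega> = ennreal l"
    using assms(2,3) by (simp add: is_Lipschitz_def)
  have "\<forall>x. \<exists>p S. sup_inf_peak l u \<omega> x p S"
    using ex_sup_inf_peak[OF assms(1,4) lip] by blast
  then obtain p S where peak: "\<And>x. sup_inf_peak l u \<omega> x (p x) (S x)" by metis
  have extension: "minimal_Lipschitz_extension k u \<omega>" if k: "\<And>x. k x = snd (p x)" for k
  proof -
    have k_eq: "k x = u x" if "x \<in> \<omega>" for x
      using sup_inf_peak_at_data[OF peak assms(4) that lip[OF _ that]] by (simp add: k)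
    have "norm (k x - k y) \<le> l * norm (x - y)" for x y
    proof -
      have "norm (k x - k y) \<le> norm (p x - p y)"
        using norm_snd_le[of "snd (p x - p y)" "fst (p x - p y)", unfolded prod.collapse]
        by (simp add: k)
      also have "\<dots> \<le> l * norm (x - y)" by (rule sup_inf_peak_Lipschitz[OF peak peak assms(4)])
      finally show ?thesis .
    qed
    then have "Lip k UNIV \<le> Lip u \<omega>" unfolding Lip_u by (intro Lip_le_ennreal)
    moreover have "Lip u \<omega> \<le> Lip k UNIV" by (rule Lip_le_of_extension[OF k_eq]) auto
    ultimately show ?thesis
      using k_eq by (auto simp: minimal_Lipschitz_extension_def intro: antisym)
  qed
  show ?thesis
    using extension k_plus_eq_snd_peak[OF peak assms(4) lip]
      k_minus_eq_snd_peak[OF peak assms(4) lip] by blast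
qed

end
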